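(* Let a singular value decomposition of the Fisher information matrix $F(t_{\mathrm f})$ be given with decreasing singular values $\lambda_k$ such that $\lambda_k>0$ for all $k \in \{1,\dots,n_t\}$. Let $1 \le n_s < n_t$. Then, with the functions $\Gamma^{D,i}_{n}$, $\Gamma^{A,i}_{n}$ ($n\in\{n_s,n_t\}$), the local information gains $P^i$ and the criterion $\phi_D$ defined in the context, for every $i\in\{1,\dots,n_y\}$ and $t\in[0,t_{\mathrm f}]$, $$\Gamma^{D,i}_{n_t}(t) - \Gamma^{D,i}_{n_s}(t) = \phi_D\big(F_{\mathrm{SVD}_{n_t}}(t_{\mathrm f})\big) \sum_{k=n_s+1}^{n_t} P^i_{kk}(t)\, \lambda_k^{-1}$$ and $$\Gamma^{A,i}_{n_t}(t) - \Gamma^{A,i}_{n_s}(t) = \frac{1}{n_t} \sum_{k=n_s+1}^{n_t} P^i_{kk}(t)\, \lambda_k^{-2}.$$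
   Context: Let $x:[0,t_{\mathrm f}]\to\mathbb{R}^{n_x}$ be the solution of $\dot x=f(x,u,p)$, $x(0)=x_0(p)$, with fixed control $u$ and parameters $p\in\mathbb{R}^{n_p}$, and let $G:[0,t_{\mathrm f}]\to\mathbb{R}^{n_x\times n_p}$ be its sensitivity, $\dot G=f_x(x,u,p)G+f_p(x,u,p)$, $G(0)=\partial x_0/\partial p$. Let $h^i:\mathbb{R}^{n_x}\to\mathbb{R}$, $i=1,\dots,n_y$, be differentiable observation functions with row gradients $h^i_x$, and let $w_i:[0,t_{\mathrm f}]\to\{0,1\}$ be fixed (measurable) sampling functions. The Fisher information matrix is the symmetric positive semidefinite matrix $$F(t_{\mathrm f})=\int_0^{t_{\mathrm f}}\sum_{i=1}^{n_y}w_i(t)\,(h^i_x(x(t))G(t))^T(h^i_x(x(t))G(t))\,\mathrm{d}t\in\mathbb{R}^{n_p\times n_p}.$$ Its singular value decomposition is written $F(t_{\mathrm f})=\hat V\hat D\hat V^T$ with $\hat V=(v_1,\dots,v_{n_p})$ orthogonal and $\hat D=\mathrm{diag}(\lambda_1,\dots,\lambda_{n_p})$, $\lambda_1\ge\lambda_2\ge\dots\ge\lambda_{n_p}$; $n_t\le n_p$. For $1\le n\le n_t$ let $V_n=(v_1,\dots,v_n)\in\mathbb{R}^{n_p\times n}$ and define the reduced sensitivities $G_{\mathrm{SVD}_n}(t)=G(t)V_n$ and the reduced Fisher information matrix $F_{\mathrm{SVD}_n}(t_{\mathrm f})=V_n^TF(t_{\mathrm f})V_n=\mathrm{diag}(\lambda_1,\dots,\lambda_n)$.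 The local information gain of measurement function $i$ is $P^i(t)=(h^i_x(x(t))G_{\mathrm{SVD}_n}(t))^T(h^i_x(x(t))G_{\mathrm{SVD}_n}(t))\in\mathbb{R}^{n\times n}$; its entries $P^i_{kl}(t)$, $k,l\le n$, do not depend on $n$. The global information gain is $$\Pi^i_{\mathrm{SVD}_n}(t)=F_{\mathrm{SVD}_n}(t_{\mathrm f})^{-1}\,P^i(t)\,F_{\mathrm{SVD}_n}(t_{\mathrm f})^{-1}.$$ For an invertible $n\times n$ matrix $M$ put $\phi_D(M)=\det(M^{-1})^{1/n}$. Define the scaling factors $$\gamma^D_n=\frac{\phi_D(F_{\mathrm{SVD}_{n_t}}(t_{\mathrm f}))}{\phi_D(F_{\mathrm{SVD}_n}(t_{\mathrm f}))},\qquad \gamma^A_n=\frac{n}{n_t},$$ and the functions $$\Gamma^{D,i}_n(t)=\gamma^D_n\,\big(\det(F_{\mathrm{SVD}_n}(t_{\mathrm f})^{-1})\big)^{1/n}\sum_{k,l=1}^n(F_{\mathrm{SVD}_n}(t_{\mathrm f}))_{kl}\,(\Pi^i_{\mathrm{SVD}_n}(t))_{kl},$$ $$\Gamma^{A,i}_n(t)=\frac{\gamma^A_n}{n}\,\mathrm{tr}\big(\Pi^i_{\mathrm{SVD}_n}(t)\big).$$ *)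

theory Defs
  imports
    "HOL-Analysis.Analysis"
    "Jordan_Normal_Form.Determinant"
    "Jordan_Normal_Form.Gauss_Jordan_Elimination"
begin

text \<open>
  State and parameter space are the Euclidean spaces \<open>real ^ 'nx\<close> and \<open>real ^ 'np\<close>, so that
  Jacobians and integrals are those of the Analysis library. The reduced matrices have a size
  \<open>n\<close> that is a number, not a type, so they are matrices with explicit dimensions. All indices
  of such matrices, and hence of the singular values, start at 0: the singular values
  \<open>\<lambda>\<^sub>1, \<dots>, \<lambda>\<^sub>n\<close> are \<open>lam 0, \<dots>, lam (n - 1)\<close>.
\<close>

text \<open>
  The passage from one kind of matrix to the other numbers rows and columns by the fixed
  bijections \<open>from_nat_into UNIV\<close> from \<open>{..<CARD('m)}\<close> and \<open>{..<CARD('n)}\<close> onto the index types.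
\<close>

definition to_mat :: "real ^ 'n ^ 'm \<Rightarrow> real mat" where
  "to_mat A = Matrix.mat CARD('m) CARD('n)
     (\<lambda>(i, j). vec_nth (vec_nth A (from_nat_into UNIV i)) (from_nat_into UNIV j))"

text \<open>
  Differential equations are meant in the sense of Caratheodory (integral form), which allows
  discontinuous controls. Since the integral is the gauge integral, every function with
  \<open>(y has_vector_derivative g t (y t)) (at t within {0..tf})\<close> for all \<open>t \<in> {0..tf}\<close> and
  \<open>y 0 = y0\<close> is a solution.
\<close>

definition ode_solution ::
  "real \<Rightarrow> (real \<Rightarrow> 'a \<Rightarrow> 'a) \<Rightarrow> 'a \<Rightarrow> (real \<Rightarrow> 'a::real_normed_vector) \<Rightarrow> bool" where
  "ode_solution tf g y0 y \<longleftrightarrow>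
     y 0 = y0 \<and> (\<forall>t\<in>{0..tf}. ((\<lambda>s. g s (y s)) has_integral (y t - y 0)) {0..t})"

text \<open>The row gradient of a scalar function, as a matrix with one row.\<close>

definition row_gradient :: "(real ^ 'nx \<Rightarrow> real) \<Rightarrow> real ^ 'nx \<Rightarrow> real ^ 'nx ^ 1" where
  "row_gradient h \<xi> = jacobian (\<lambda>z. (\<chi> _. h z) :: real ^ 1) (at \<xi>)"

text \<open>If the integrand is not integrable, the library integral below is the zero matrix.\<close>

definition fisher_information ::
  "real \<Rightarrow> nat \<Rightarrow> (nat \<Rightarrow> real \<Rightarrow> real) \<Rightarrow> (nat \<Rightarrow> real ^ 'nx \<Rightarrow> real) \<Rightarrow>
   (real \<Rightarrow> real ^ 'nx) \<Rightarrow> (real \<Rightarrow> real ^ 'np ^ 'nx) \<Rightarrow> real ^ 'np ^ 'np" where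
  "fisher_information tf ny w h x G =
     (LINT t:{0..tf}|lebesgue.
        (\<Sum>i=1..ny. w i t *\<^sub>R
           (transpose (row_gradient (h i) (x t) ** G t) ** (row_gradient (h i) (x t) ** G t))))"

text \<open>The library predicate \<^const>\<open>orthogonal_mat\<close> does not require normalised columns.\<close>

definition orthonormal_mat :: "nat \<Rightarrow> real mat \<Rightarrow> bool" where
  "orthonormal_mat n U \<longleftrightarrow>
     U \<in> carrier_mat n n \<and> transpose_mat U * U = 1\<^sub>m n \<and> U * transpose_mat U = 1\<^sub>m n"

definition is_svd :: "nat \<Rightarrow> real mat \<Rightarrow> real mat \<Rightarrow> (nat \<Rightarrow> real) \<Rightarrow> real mat \<Rightarrow> bool" where
  "is_svd n A U lam V \<longleftrightarrow>
     orthonormal_mat n U \<and> orthonormal_mat n V \<and>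
     (\<forall>k<n. 0 \<le> lam k) \<and> (\<forall>k l. k \<le> l \<longrightarrow> l < n \<longrightarrow> lam l \<le> lam k) \<and>
     A = U * mat_diag n lam * transpose_mat V"

definition leading_cols :: "real mat \<Rightarrow> nat \<Rightarrow> real mat" where
  "leading_cols V n = Matrix.mat (dim_row V) n (\<lambda>(i, j). V $$ (i, j))"

text \<open>For a singular matrix the value of \<open>mat_inv\<close> is unspecified.\<close>

definition mat_inv :: "real mat \<Rightarrow> real mat" where
  "mat_inv A = the (mat_inverse A)"

definition mat_trace :: "real mat \<Rightarrow> real" where
  "mat_trace A = sum_list (diag_mat A)"

definition reduced_sens :: "(real \<Rightarrow> real ^ 'np ^ 'nx) \<Rightarrow> real mat \<Rightarrow> nat \<Rightarrow> real \<Rightarrow> real mat" where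
  "reduced_sens G V n t = to_mat (G t) * leading_cols V n"

definition reduced_fim :: "real ^ 'np ^ 'np \<Rightarrow> real mat \<Rightarrow> nat \<Rightarrow> real mat" where
  "reduced_fim F V n = transpose_mat (leading_cols V n) * to_mat F * leading_cols V n"

definition local_gain ::
  "(real ^ 'nx \<Rightarrow> real) \<Rightarrow> (real \<Rightarrow> real ^ 'nx) \<Rightarrow> (real \<Rightarrow> real ^ 'np ^ 'nx) \<Rightarrow>
   real mat \<Rightarrow> nat \<Rightarrow> real \<Rightarrow> real mat" where
  "local_gain hi x G V n t =
     transpose_mat (to_mat (row_gradient hi (x t)) * reduced_sens G V n t)
       * (to_mat (row_gradient hi (x t)) * reduced_sens G V n t)"

definition global_gain ::
  "real ^ 'np ^ 'np \<Rightarrow> (real ^ 'nx \<Rightarrow> real) \<Rightarrow> (real \<Rightarrow> real ^ 'nx) \<Rightarrow>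
   (real \<Rightarrow> real ^ 'np ^ 'nx) \<Rightarrow> real mat \<Rightarrow> nat \<Rightarrow> real \<Rightarrow> real mat" where
  "global_gain F hi x G V n t =
     mat_inv (reduced_fim F V n) * local_gain hi x G V n t * mat_inv (reduced_fim F V n)"

definition phi_D :: "real mat \<Rightarrow> real" where
  "phi_D M = root (dim_row M) (Determinant.det (mat_inv M))"

definition gamma_D :: "real ^ 'np ^ 'np \<Rightarrow> real mat \<Rightarrow> nat \<Rightarrow> nat \<Rightarrow> real" where
  "gamma_D F V nt n = phi_D (reduced_fim F V nt) / phi_D (reduced_fim F V n)"

definition gamma_A :: "nat \<Rightarrow> nat \<Rightarrow> real" where
  "gamma_A nt n = real n / real nt"

definition Gamma_D ::
  "real ^ 'np ^ 'np \<Rightarrow> (real ^ 'nx \<Rightarrow> real) \<Rightarrow> (real \<Rightarrow> real ^ 'nx) \<Rightarrow>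
   (real \<Rightarrow> real ^ 'np ^ 'nx) \<Rightarrow> real mat \<Rightarrow> nat \<Rightarrow> nat \<Rightarrow> real \<Rightarrow> real" where
  "Gamma_D F hi x G V nt n t =
     gamma_D F V nt n * root n (Determinant.det (mat_inv (reduced_fim F V n)))
       * (\<Sum>k<n. \<Sum>l<n. reduced_fim F V n $$ (k, l) * global_gain F hi x G V n t $$ (k, l))"

definition Gamma_A ::
  "real ^ 'np ^ 'np \<Rightarrow> (real ^ 'nx \<Rightarrow> real) \<Rightarrow> (real \<Rightarrow> real ^ 'nx) \<Rightarrow>
   (real \<Rightarrow> real ^ 'np ^ 'nx) \<Rightarrow> real mat \<Rightarrow> nat \<Rightarrow> nat \<Rightarrow> real \<Rightarrow> real" where
  "Gamma_A F hi x G V nt n t =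
     gamma_A nt n / real n * mat_trace (global_gain F hi x G V n t)"

end

theory Submission
  imports Defs
begin

text \<open>
  Because \<open>V\<close> is orthogonal, the reduced Fisher matrix is \<open>diag (\<lambda>\<^sub>1, \<dots>, \<lambda>\<^sub>n)\<close>, so only the
  diagonal entries of the local gain enter the two criteria. The scaling factors are chosen so
  that the weights of these entries do not depend on \<open>n\<close>: the difference of the criteria is the
  tail of a single sum.
\<close>

section \<open>Leading columns and the diagonal form of the reduced Fisher matrix\<close>

lemma dim_leading_cols [simp]:
  "dim_row (leading_cols V n) = dim_row V" "dim_col (leading_cols V n) = n"
  by (simp_all add: leading_cols_def)

lemma index_leading_cols [simp]:
  "i < dim_row V \<Longrightarrow> j < n \<Longrightarrow> leading_cols V n $$ (i, j) = V $$ (i, j)"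
  by (simp add: leading_cols_def)

lemma leading_cols_carrier [simp]:
  "V \<in> carrier_mat m k \<Longrightarrow> leading_cols V n \<in> carrier_mat m n"
  by (auto simp: leading_cols_def)

lemma to_mat_carrier [simp]:
  fixes A :: "real ^ 'n ^ 'm"
  shows "to_mat A \<in> carrier_mat CARD('m) CARD('n)"
  by (simp add: to_mat_def)

lemma dim_to_mat [simp]:
  fixes A :: "real ^ 'n ^ 'm"
  shows "dim_row (to_mat A) = CARD('m)" "dim_col (to_mat A) = CARD('n)"
  by (simp_all add: to_mat_def)

text \<open>Column \<open>j\<close> of a product depends only on column \<open>j\<close> of its
  right factor. The bound \<open>n \<le> l\<close> keeps the selected columns inside
  \<open>V\<close>, where entries are specified.\<close>

lemma mult_leading_cols:
  assumes "A \<in> carrier_mat m k" "V \<in> carrier_mat k l" "n \<le> l"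
  shows "A * leading_cols V n = leading_cols (A * V) n"
proof (rule eq_matI)
  note dims = carrier_matD[OF assms(1)] carrier_matD[OF assms(2)]
  fix i j assume "i < dim_row (leading_cols (A * V) n)" "j < dim_col (leading_cols (A * V) n)"
  then have ij: "i < m" "j < n"
    using dims by simp_all
  have "col (leading_cols V n) j = col V j"
    using ij(2) assms(3) by (intro eq_vecI) (simp_all add: dims)
  moreover have "leading_cols (A * V) n $$ (i, j) = (A * V) $$ (i, j)"
    using ij dims by (intro index_leading_cols) simp_all
  ultimately show "(A * leading_cols V n) $$ (i, j) = leading_cols (A * V) n $$ (i, j)"
    using ij assms(3) by (simp add: dims)
qed simp_all

text \<open>The first \<open>n\<close> columns of the identity, transposed on the left and plain on
  the right, cut out the leading block of the matrix between them.\<close>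

lemma leading_block_diag:
  assumes "n \<le> m"
  shows "transpose_mat (leading_cols (1\<^sub>m m) n) * mat_diag m d * leading_cols (1\<^sub>m m) n
           = mat_diag n d"
proof -
  let ?E = "leading_cols (1\<^sub>m m) n :: real mat"
  have ET: "transpose_mat ?E \<in> carrier_mat n m"
    by (rule carrier_matI) simp_all
  have "transpose_mat ?E * mat_diag m d * ?E
      = leading_cols (transpose_mat ?E * mat_diag m d * 1\<^sub>m m) n"
    by (rule mult_leading_cols[OF mult_carrier_mat[OF ET mat_diag_dim] one_carrier_mat assms])
  also have "\<dots> = leading_cols (transpose_mat ?E * mat_diag m d) n"
    by (simp only: right_mult_one_mat[OF mult_carrier_mat[OF ET mat_diag_dim]])
  also have "\<dots> = mat_diag n d"
    unfolding mat_diag_mult_right[OF ET]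
    using assms by (auto simp: leading_cols_def mat_diag_def intro!: eq_matI)
  finally show ?thesis .
qed

text \<open>Orthogonality turns \<open>transpose_mat V * ?L\<close> into the first columns
  \<open>?E\<close> of the identity, so inserting the decomposition of \<open>F\<close> leaves only
  the leading block of \<open>?D\<close>. Both orthogonal factors of the decomposition are the same
  \<open>V\<close>.\<close>

lemma reduced_fim_eq_diag:
  fixes F :: "real ^ 'np ^ 'np"
  assumes svd: "is_svd CARD('np) (to_mat F) V lam V" and n: "n \<le> CARD('np)"
  shows "reduced_fim F V n = mat_diag n lam"
proof -
  let ?N = "CARD('np)" and ?L = "leading_cols V n" and ?E = "leading_cols (1\<^sub>m CARD('np)) n"
  let ?D = "mat_diag CARD('np) lam"
  have V: "V \<in> carrier_mat ?N ?N" and VV: "transpose_mat V * V = 1\<^sub>m ?N"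
    and F: "to_mat F = V * ?D * transpose_mat V"
    using svd by (simp_all add: is_svd_def orthonormal_mat_def)
  have L: "?L \<in> carrier_mat ?N n" and D: "?D \<in> carrier_mat ?N ?N"
    using V by (simp_all add: mat_diag_def)
  have VL: "transpose_mat V * ?L = ?E"
    using mult_leading_cols[of "transpose_mat V" ?N ?N V ?N n] V VV n by simp
  have LV: "transpose_mat ?L * V = transpose_mat ?E"
    using transpose_mult[of "transpose_mat V" ?N ?N ?L n] V L VL by simp
  have LT: "transpose_mat ?L \<in> carrier_mat n ?N" and VT: "transpose_mat V \<in> carrier_mat ?N ?N"
    using L V by simp_all
  \<comment> \<open>Associativity is conditional on dimensions; this carrier allows regrouping the
    product as (\<open>?L\<close>^T \<open>V\<close>) \<open>?D\<close> (\<open>V\<close>^T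
    \<open>?L\<close>).\<close>
  have X: "transpose_mat ?L * V * ?D \<in> carrier_mat n ?N"
    using LT V D by (meson mult_carrier_mat)
  have "transpose_mat ?L * to_mat F = transpose_mat ?L * V * ?D * transpose_mat V"
    unfolding F
    by (simp only: assoc_mult_mat[OF LT V D] assoc_mult_mat[OF LT mult_carrier_mat[OF V D] VT])
  then have "reduced_fim F V n = transpose_mat ?L * V * ?D * (transpose_mat V * ?L)"
    by (simp only: reduced_fim_def assoc_mult_mat[OF X VT L])
  then show ?thesis
    by (simp only: LV VL leading_block_diag[OF n])
qed

section \<open>Inverse, determinant and \<open>phi_D\<close> of a diagonal matrix\<close>

lemma mat_inv_eq:
  assumes "A \<in> carrier_mat n n" "B \<in> carrier_mat n n" "A * B = 1\<^sub>m n" "B * A = 1\<^sub>m n"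
  shows "mat_inv A = B"
proof (cases "mat_inverse A")
  \<comment> \<open>\<open>None\<close> would mean that \<open>A\<close> is no unit of the matrix
    ring, but \<open>B\<close> is a two-sided inverse.\<close>
  case None
  then have "A \<notin> Units (ring_mat TYPE(real) n ())"
    by (rule mat_inverse(1)[OF assms(1)])
  with assms show ?thesis
    by (auto simp: Units_def ring_mat_simps)
next
  case (Some C)
  then have C: "A * C = 1\<^sub>m n" "C * A = 1\<^sub>m n" "C \<in> carrier_mat n n"
    using mat_inverse(2)[OF assms(1) Some] by blast+
  \<comment> \<open>Uniqueness of the inverse: a left inverse \<open>C\<close> and a right inverse
    \<open>B\<close> agree.\<close>
  have "C = C * (A * B)"
    using C assms by simp
  also have "\<dots> = C * A * B"
    by (rule assoc_mult_mat[symmetric]) (use C assms in auto)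
  finally show ?thesis
    using Some C assms by (simp add: mat_inv_def)
qed

lemma mat_diag_inverse:
  fixes d :: "nat \<Rightarrow> real"
  assumes "\<And>k. k < n \<Longrightarrow> d k \<noteq> 0"
  shows "mat_diag n (\<lambda>k. d k * inverse (d k)) = 1\<^sub>m n"
    and "mat_diag n (\<lambda>k. inverse (d k) * d k) = 1\<^sub>m n"
  using assms by (auto simp: mat_diag_def)

lemma mat_inv_diag:
  assumes "\<And>k. k < n \<Longrightarrow> d k \<noteq> 0"
  shows "mat_inv (mat_diag n d) = mat_diag n (\<lambda>k. inverse (d k))"
  by (rule mat_inv_eq) (use assms in \<open>simp_all add: mat_diag_inverse\<close>)

lemma det_mat_diag: "Determinant.det (mat_diag n d) = (\<Prod>k<n. d k)" for d :: "nat \<Rightarrow> real"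
  by (subst det_upper_triangular[where n = n])
     (auto simp: mat_diag_def diag_mat_def prod.list_conv_set_nth atLeast0LessThan)

text \<open>Serves to cancel the denominator of \<open>gamma_D\<close>. The determinant of the
  inverse is a product of positive reciprocals; \<open>0 < n\<close> is required since
  \<open>root 0\<close> is constantly zero.\<close>

lemma phi_D_diag_pos:
  assumes "0 < n" "\<And>k. k < n \<Longrightarrow> 0 < d k"
  shows "0 < phi_D (mat_diag n d)"
proof -
  have "mat_inv (mat_diag n d) = mat_diag n (\<lambda>k. inverse (d k))"
    using assms(2) by (intro mat_inv_diag) force
  moreover have "0 < (\<Prod>k<n. inverse (d k))"
    using assms(2) by (intro prod_pos) simp
  moreover have "dim_row (mat_diag n d) = n"
    by (simp add: mat_diag_def)
  ultimately show ?thesis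
    using assms(1) by (simp add: phi_D_def det_mat_diag)
qed

section \<open>Entries of the information gains, and the criteria as weighted diagonal sums\<close>

lemma local_gain_carrier:
  "local_gain hi x G V n t \<in> carrier_mat n n"
  by (rule carrier_matI) (simp_all add: local_gain_def reduced_sens_def)

text \<open>The gain is built from the leading columns of one row matrix, gradient times sensitivity
  times \<open>V\<close>. Entry \<open>(k, l)\<close> is the product of entries \<open>k\<close> and
  \<open>l\<close> of that row, whatever the truncation.\<close>

lemma local_gain_entry_independent:
  fixes G :: "real \<Rightarrow> real ^ 'np ^ 'nx"
  assumes V: "V \<in> carrier_mat CARD('np) CARD('np)"
    and n: "n \<le> m" "m \<le> CARD('np)" and kl: "k < n" "l < n"
  shows "local_gain hi x G V n t $$ (k, l) = local_gain hi x G V m t $$ (k, l)"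
proof -
  define A where "A = to_mat (row_gradient hi (x t)) * to_mat (G t)"
  have A: "A \<in> carrier_mat 1 CARD('np)"
    by (rule carrier_matI) (simp_all add: A_def)
  have *: "to_mat (row_gradient hi (x t)) * reduced_sens G V j t = leading_cols (A * V) j"
    if "j \<le> CARD('np)" for j
  proof -
    have "to_mat (row_gradient hi (x t)) * reduced_sens G V j t = A * leading_cols V j"
      unfolding reduced_sens_def A_def
      by (rule assoc_mult_mat[symmetric]) (rule to_mat_carrier leading_cols_carrier[OF V])+
    then show ?thesis
      by (simp only: mult_leading_cols[OF A V that])
  qed
  show ?thesis
    using n kl A by (simp add: local_gain_def * leading_cols_def scalar_prod_def)
qed

text \<open>The inverse of the reduced Fisher matrix is diagonal, so on the left it scales rows and
  on the right columns.\<close>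

lemma global_gain_entry:
  fixes F :: "real ^ 'np ^ 'np"
  assumes svd: "is_svd CARD('np) (to_mat F) V lam V" and n: "n \<le> CARD('np)"
    and pos: "\<And>k. k < n \<Longrightarrow> 0 < lam k"
  shows "global_gain F hi x G V n t \<in> carrier_mat n n"
    and "k < n \<Longrightarrow> l < n \<Longrightarrow> global_gain F hi x G V n t $$ (k, l)
           = inverse (lam k) * local_gain hi x G V n t $$ (k, l) * inverse (lam l)"
proof -
  have "mat_inv (reduced_fim F V n) = mat_diag n (\<lambda>k. inverse (lam k))"
    unfolding reduced_fim_eq_diag[OF svd n] using pos by (intro mat_inv_diag) force
  then have *: "global_gain F hi x G V n t = Matrix.mat n n
      (\<lambda>(i, j). inverse (lam i) * local_gain hi x G V n t $$ (i, j) * inverse (lam j))"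
    by (simp only: global_gain_def mat_diag_mult_left[OF local_gain_carrier]
        mat_diag_mult_right[OF mat_carrier]) (rule eq_matI; simp)
  show "global_gain F hi x G V n t \<in> carrier_mat n n"
    by (simp add: *)
  show "k < n \<Longrightarrow> l < n \<Longrightarrow> global_gain F hi x G V n t $$ (k, l)
           = inverse (lam k) * local_gain hi x G V n t $$ (k, l) * inverse (lam l)"
    by (simp add: *)
qed

text \<open>The root of the determinant equals the denominator of \<open>gamma_D\<close> and cancels
  against it, which leaves \<open>phi_D\<close> at size \<open>nt\<close>. The gain is also taken at
  size \<open>nt\<close>, so that the sums for different \<open>n\<close> share their
  summands.\<close>

lemma Gamma_D_eq:
  fixes F :: "real ^ 'np ^ 'np"
  assumes svd: "is_svd CARD('np) (to_mat F) V lam V" and n: "0 < n" "n \<le> nt" "nt \<le> CARD('np)"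
    and pos: "\<And>k. k < nt \<Longrightarrow> 0 < lam k"
  shows "Gamma_D F hi x G V nt n t = phi_D (reduced_fim F V nt)
           * (\<Sum>k<n. local_gain hi x G V nt t $$ (k, k) * inverse (lam k))"
proof -
  have le: "n \<le> CARD('np)" and pos': "\<And>k. k < n \<Longrightarrow> 0 < lam k"
    using n pos by auto
  have V: "V \<in> carrier_mat CARD('np) CARD('np)"
    using svd by (simp add: is_svd_def orthonormal_mat_def)
  note diag = reduced_fim_eq_diag[OF svd le]
  have root: "root n (Determinant.det (mat_inv (reduced_fim F V n))) = phi_D (reduced_fim F V n)"
    by (simp only: phi_D_def diag carrier_matD(1)[OF mat_diag_dim])
  have "phi_D (reduced_fim F V n) \<noteq> 0"
    unfolding diag using phi_D_diag_pos[of n lam] n(1) pos' by force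
  \<comment> \<open>Row \<open>k\<close> of the diagonal Fisher matrix keeps only
    \<open>l = k\<close>; its entry \<open>lam k\<close> absorbs one of the two reciprocals in the
    global gain.\<close>
  moreover have "(\<Sum>l<n. reduced_fim F V n $$ (k, l) * global_gain F hi x G V n t $$ (k, l))
      = local_gain hi x G V nt t $$ (k, k) * inverse (lam k)" if "k < n" for k
  proof -
    have "(\<Sum>l<n. reduced_fim F V n $$ (k, l) * global_gain F hi x G V n t $$ (k, l))
        = (\<Sum>l<n. if k = l then lam k * global_gain F hi x G V n t $$ (k, k) else 0)"
      using that by (intro sum.cong) (auto simp: diag mat_diag_def)
    also have "\<dots> = lam k * global_gain F hi x G V n t $$ (k, k)"
      using that by simp
    also have "\<dots> = local_gain hi x G V n t $$ (k, k) * inverse (lam k)"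
      using that pos'[OF that] by (simp add: global_gain_entry(2)[OF svd le pos'])
    finally show ?thesis
      by (simp only: local_gain_entry_independent[OF V n(2,3) that that])
  qed
  ultimately show ?thesis
    by (simp add: Gamma_D_def gamma_D_def root)
qed

text \<open>The scaling turns the prefactor \<open>1 / n\<close> into \<open>1 / nt\<close>. In the
  trace both reciprocals of the global gain survive, hence the square.\<close>

lemma Gamma_A_eq:
  fixes F :: "real ^ 'np ^ 'np"
  assumes svd: "is_svd CARD('np) (to_mat F) V lam V" and n: "0 < n" "n \<le> nt" "nt \<le> CARD('np)"
    and pos: "\<And>k. k < nt \<Longrightarrow> 0 < lam k"
  shows "Gamma_A F hi x G V nt n t
           = 1 / real nt * (\<Sum>k<n. local_gain hi x G V nt t $$ (k, k) * inverse (lam k ^ 2))"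
proof -
  have le: "n \<le> CARD('np)" and pos': "\<And>k. k < n \<Longrightarrow> 0 < lam k"
    using n pos by auto
  have V: "V \<in> carrier_mat CARD('np) CARD('np)"
    using svd by (simp add: is_svd_def orthonormal_mat_def)
  have dim: "dim_row (global_gain F hi x G V n t) = n"
    using global_gain_entry(1)[OF svd le pos'] by (rule carrier_matD(1))
  have "mat_trace (global_gain F hi x G V n t) = (\<Sum>k<n. global_gain F hi x G V n t $$ (k, k))"
    by (simp add: mat_trace_def diag_mat_def dim interv_sum_list_conv_sum_set_nat
        atLeast0LessThan)
  also have "\<dots> = (\<Sum>k<n. local_gain hi x G V nt t $$ (k, k) * inverse (lam k ^ 2))"
    by (intro sum.cong)
       (simp_all add: global_gain_entry(2)[OF svd le pos']
          local_gain_entry_independent[OF V n(2,3)] power2_eq_square)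
  finally show ?thesis
    using n by (simp add: Gamma_A_def gamma_A_def)
qed

theorem lemma8:
  fixes f :: "real ^ 'nx \<Rightarrow> 'u \<Rightarrow> real ^ 'np \<Rightarrow> real ^ 'nx"
    and u :: "real \<Rightarrow> 'u" and p :: "real ^ 'np" and x0 :: "real ^ 'np \<Rightarrow> real ^ 'nx"
    and x :: "real \<Rightarrow> real ^ 'nx" and G :: "real \<Rightarrow> real ^ 'np ^ 'nx"
    and h :: "nat \<Rightarrow> real ^ 'nx \<Rightarrow> real" and w :: "nat \<Rightarrow> real \<Rightarrow> real"
    and F :: "real ^ 'np ^ 'np" and V :: "real mat" and lam :: "nat \<Rightarrow> real"
    and tf :: real and ny ns nt :: nat
  assumes "0 \<le> tf"
    and "x0 differentiable (at p)"
    and "\<And>t. t \<in> {0..tf} \<Longrightarrow> (\<lambda>z. f z (u t) p) differentiable (at (x t))"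
    and "\<And>t. t \<in> {0..tf} \<Longrightarrow> (\<lambda>q. f (x t) (u t) q) differentiable (at p)"
    and "ode_solution tf (\<lambda>t z. f z (u t) p) (x0 p) x"
    and "ode_solution tf
           (\<lambda>t Y. jacobian (\<lambda>z. f z (u t) p) (at (x t)) ** Y
                   + jacobian (\<lambda>q. f (x t) (u t) q) (at p))
           (jacobian x0 (at p)) G"
    and "\<And>i z. i \<in> {1..ny} \<Longrightarrow> h i differentiable (at z)"
    and "\<And>i. i \<in> {1..ny} \<Longrightarrow> w i \<in> borel_measurable (lebesgue_on {0..tf})"
    and "\<And>i t. i \<in> {1..ny} \<Longrightarrow> t \<in> {0..tf} \<Longrightarrow> w i t \<in> {0, 1}"
    and "F = fisher_information tf ny w h x G"
    and "is_svd CARD('np) (to_mat F) V lam V"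
    and "nt \<le> CARD('np)"
    and "\<And>k. k < nt \<Longrightarrow> 0 < lam k"
    and "1 \<le> ns" and "ns < nt"
  shows "\<forall>i\<in>{1..ny}. \<forall>t\<in>{0..tf}.
           Gamma_D F (h i) x G V nt nt t - Gamma_D F (h i) x G V nt ns t
             = phi_D (reduced_fim F V nt)
                 * (\<Sum>k=ns..<nt. local_gain (h i) x G V nt t $$ (k, k) * inverse (lam k)) \<and>
           Gamma_A F (h i) x G V nt nt t - Gamma_A F (h i) x G V nt ns t
             = 1 / real nt
                 * (\<Sum>k=ns..<nt. local_gain (h i) x G V nt t $$ (k, k) * inverse (lam k ^ 2))"
proof (intro ballI)
  fix i t
  have nt: "0 < nt" and le: "ns \<le> nt"
    using \<open>1 \<le> ns\<close> \<open>ns < nt\<close> by auto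
  \<comment> \<open>The conditions on \<open>n\<close> stay open, so each formula applies to
    \<open>n = nt\<close> and to \<open>n = ns\<close>.\<close>
  note D = Gamma_D_eq[OF assms(11) _ _ assms(12,13)] and A = Gamma_A_eq[OF assms(11) _ _ assms(12,13)]
  \<comment> \<open>With indices from 0, the range \<open>ns..<nt\<close> stands for the singular
    values numbered \<open>ns + 1\<close> to \<open>nt\<close> when counting from 1.\<close>
  have split: "(\<Sum>k<nt. g k) - (\<Sum>k<ns. g k) = (\<Sum>k=ns..<nt. g k)" for g :: "nat \<Rightarrow> real"
    using sum_diff_nat_ivl[of 0 ns nt g] le by (simp add: atLeast0LessThan)
  show "Gamma_D F (h i) x G V nt nt t - Gamma_D F (h i) x G V nt ns t
             = phi_D (reduced_fim F V nt)
                 * (\<Sum>k=ns..<nt. local_gain (h i) x G V nt t $$ (k, k) * inverse (lam k)) \<and>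
           Gamma_A F (h i) x G V nt nt t - Gamma_A F (h i) x G V nt ns t
             = 1 / real nt
                 * (\<Sum>k=ns..<nt. local_gain (h i) x G V nt t $$ (k, k) * inverse (lam k ^ 2))"
    using \<open>1 \<le> ns\<close> nt le by (simp only: D A split flip: right_diff_distrib)
qed

end
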